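(* Let $n\ge 1$, $N\ge 1$, and let $V_X\in C^2(\mathbb{R})$ be a real-valued function for each $X\in\mathbb{Z}^n$. Assume that the functions $$K_X^{\pm}(\lambda,\mu)=B_X(\lambda,\mu)+2\,\partial_\lambda B_X(\lambda,\mu)\,(\lambda\pm\sqrt{\lambda\mu})$$ are bounded from below: $$k_2:=\inf_{\pm,\ X\in\mathbb{Z}^n,\ \lambda\ge 0,\ \mu\ge 0}K_X^{\pm}(\lambda,\mu)>-\infty .$$ Define $\tau_2=\sqrt{-1/k_2}$ if $k_2<0$ and $\tau_2=+\infty$ if $k_2\ge 0$. Then for any $\tau\in(0,\tau_2)$, any $\varepsilon>0$, and arbitrary initial data $\psi^0,\psi^1:\mathbb{Z}^n\to\mathbb{C}^N$, there exists a solution $\psi:\mathbb{Z}^n\times\mathbb{Z}\to\mathbb{C}^N$ to the Cauchy problem for the discrete nonlinear wave equation $$\frac{\psi_X^{T+1}-2\psi_X^T+\psi_X^{T-1}}{\tau^2}=\sum_{j=1}^n\frac{\psi_{X+e_j}^T-2\psi_X^T+\psi_{X-e_j}^T}{\varepsilon^2}-B_X(|\psi_X^{T+1}|^2,|\psi_X^{T-1}|^2)\,(\psi_X^{T+1}+\psi_X^{T-1}),\qquad (X,T)\in\mathbb{Z}^n\times\mathbb{Z},$$ with the values of $\psi^T$ at $T=0$ and $T=1$ equal to the given $\psi^0$ and $\psi^1$, and this solution is unique.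
   Context: The unknown is a function $\psi:\mathbb{Z}^n\times\mathbb{Z}\to\mathbb{C}^N$, $(X,T)\mapsto\psi_X^T$; $\psi^T$ denotes the function $X\mapsto\psi_X^T$ on $\mathbb{Z}^n$. Here $e_1,\dots,e_n$ is the standard basis of $\mathbb{Z}^n$ and $|\psi|^2=\bar\psi\cdot\psi$ for $\psi\in\mathbb{C}^N$. For $X\in\mathbb{Z}^n$ and $\lambda,\mu\in\mathbb{R}$, $$B_X(\lambda,\mu)=\frac{V_X(\lambda)-V_X(\mu)}{\lambda-\mu}\ \text{ if }\lambda\ne\mu,\qquad B_X(\lambda,\lambda)=\partial_\lambda V_X(\lambda),$$ and $\partial_\lambda B_X(\lambda,\mu)$ is the partial derivative of $B_X$ with respect to its first argument. *)

theory Defs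
  imports "HOL-Analysis.Analysis" "HOL-Library.Extended_Real"
begin

definition C2_real :: "(real \<Rightarrow> real) \<Rightarrow> bool" where
  "C2_real f \<longleftrightarrow>
     (\<forall>x. f differentiable (at x)) \<and>
     (\<forall>x. deriv f differentiable (at x)) \<and>
     continuous_on UNIV (deriv (deriv f))"

definition Bfun :: "('x \<Rightarrow> real \<Rightarrow> real) \<Rightarrow> 'x \<Rightarrow> real \<Rightarrow> real \<Rightarrow> real" where
  "Bfun V X l m = (if l \<noteq> m then (V X l - V X m) / (l - m) else deriv (V X) l)"

text \<open>The sign \<open>\<pm>\<close> is the argument \<open>s\<close>, which ranges over \<open>{1, -1}\<close>. For twice
  continuously differentiable \<open>V X\<close>, the map \<open>\<lambda>t. Bfun V X t m\<close> is differentiable on the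
  whole line, also at \<open>t = m\<close>, so \<open>deriv\<close> is the actual (two-sided) partial derivative.\<close>

definition Kfun :: "('x \<Rightarrow> real \<Rightarrow> real) \<Rightarrow> real \<Rightarrow> 'x \<Rightarrow> real \<Rightarrow> real \<Rightarrow> real" where
  "Kfun V s X l m =
     Bfun V X l m + 2 * deriv (\<lambda>t. Bfun V X t m) l * (l + s * sqrt (l * m))"

definition Kvals :: "('x \<Rightarrow> real \<Rightarrow> real) \<Rightarrow> real set" where
  "Kvals V = {Kfun V s X l m | s X l m. s \<in> {1, -1} \<and> 0 \<le> l \<and> 0 \<le> m}"

text \<open>The infimum \<open>Inf (Kvals V)\<close> is taken in \<open>real\<close>; it is meaningful only when \<open>Kvals V\<close> is
  bounded below.\<close>

definition k2 :: "('x \<Rightarrow> real \<Rightarrow> real) \<Rightarrow> real" where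
  "k2 V = Inf (Kvals V)"

definition tau2 :: "('x \<Rightarrow> real \<Rightarrow> real) \<Rightarrow> ereal" where
  "tau2 V = (if k2 V < 0 then ereal (sqrt (- 1 / k2 V)) else \<infinity>)"

text \<open>The standard basis vector \<open>e\<^sub>j\<close> is \<open>axis j 1\<close>; the norm on \<open>complex ^ 'N\<close> is
  the Hermitian one.\<close>

definition discrete_wave_solution ::
  "(int ^ 'n \<Rightarrow> real \<Rightarrow> real) \<Rightarrow> real \<Rightarrow> real \<Rightarrow>
   (int ^ 'n \<Rightarrow> int \<Rightarrow> complex ^ 'N) \<Rightarrow> bool" where
  "discrete_wave_solution V \<tau> \<epsilon> \<psi> \<longleftrightarrow>
     (\<forall>X T.
        (\<psi> X (T + 1) - 2 *\<^sub>R \<psi> X T + \<psi> X (T - 1)) /\<^sub>R \<tau>\<^sup>2 =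
        (\<Sum>j\<in>UNIV. (\<psi> (X + axis j 1) T - 2 *\<^sub>R \<psi> X T + \<psi> (X - axis j 1) T) /\<^sub>R \<epsilon>\<^sup>2)
        - Bfun V X ((norm (\<psi> X (T + 1)))\<^sup>2) ((norm (\<psi> X (T - 1)))\<^sup>2)
            *\<^sub>R (\<psi> X (T + 1) + \<psi> X (T - 1)))"

end

theory Submission
  imports Defs
begin

text \<open>Since \<open>B\<close> is symmetric, the equation is time-reversible, so it suffices to solve it uniquely for
  \<open>\<psi>\<^sup>T\<^sup>+\<^sup>1\<close>. With \<open>u = \<psi>\<^sup>T\<^sup>-\<^sup>1\<close> and \<open>v = \<psi>\<^sup>T\<^sup>+\<^sup>1 + u\<close> it becomes, at each \<open>X\<close> separately,
  \<open>(1 + \<tau>\<^sup>2 B(|v - u|\<^sup>2, |u|\<^sup>2)) v = \<eta>\<close> with a known vector \<open>\<eta>\<close>. Hence \<open>v\<close> is a real multiple \<open>s\<close> of a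
  fixed unit vector, and \<open>s\<close> solves a scalar equation whose left-hand side has derivative
  \<open>1 + \<tau>\<^sup>2 (B + 2 \<partial>\<^sub>\<lambda>B (\<lambda> + w \<bullet> u))\<close>, where \<open>w = v - u\<close> and \<open>\<lambda> = |w|\<^sup>2\<close>. As \<open>|w \<bullet> u| \<le> \<surd>(\<lambda>\<mu>)\<close>, where
  \<open>\<mu> = |u|\<^sup>2\<close>, the bracket is a convex combination of \<open>K\<^sup>+\<close> and \<open>K\<^sup>-\<close>, so this derivative is at least
  \<open>1 + \<tau>\<^sup>2 min(k\<^sub>2, 0) > 0\<close> and the scalar map is a bijection of the line.\<close>

section \<open>Symmetry and differentiability of the divided difference\<close>

lemma Bfun_commute: "Bfun V X l m = Bfun V X m l"
  unfolding Bfun_def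
  by (simp, metis minus_diff_eq minus_divide_divide)

text \<open>Only the diagonal \<open>l = m\<close> is delicate, since the quotient formula
  degenerates there. A second-order expansion of \<open>V X\<close> at \<open>m\<close> gives the
  slope, half the second derivative. With this the \<open>deriv\<close> in \<open>Kfun\<close> is a
  genuine derivative and the chain rule may be applied to it.\<close>

lemma Bfun_differentiable:
  assumes "C2_real (V X)"
  shows "(\<lambda>t. Bfun V X t m) differentiable (at l)"
proof (cases "l = m")
  case False
  have "(V X has_real_derivative deriv (V X) l) (at l)"
    using assms by (simp add: C2_real_def DERIV_deriv_iff_real_differentiable)
  then have "((\<lambda>t. (V X t - V X m) / (t - m)) has_real_derivative
      (deriv (V X) l * (l - m) - (V X l - V X m)) / ((l - m) * (l - m))) (at l)"
    using False by (auto intro!: derivative_eq_intros)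
  then have "((\<lambda>t. Bfun V X t m) has_real_derivative
      (deriv (V X) l * (l - m) - (V X l - V X m)) / ((l - m) * (l - m))) (at l)"
    by (rule has_field_derivative_transform_within_open[where S = "- {m}"])
       (use False in \<open>auto simp: Bfun_def\<close>)
  then show ?thesis
    using real_differentiable_def by blast
next
  case True
  define f where "f = V X"
  define D where "D = deriv (deriv f) m"
  have f: "(f has_real_derivative deriv f x) (at x)" for x
    using assms by (simp add: f_def C2_real_def DERIV_deriv_iff_real_differentiable)
  have f': "(deriv f has_real_derivative D) (at m)"
    using assms by (simp add: f_def D_def C2_real_def DERIV_deriv_iff_real_differentiable)
  \<comment> \<open>\<open>g\<close> is the first-order Taylor remainder at \<open>m\<close>; for
    \<open>t \<noteq> m\<close>, \<open>g t / (t - m)\<^sup>2\<close> is exactly the difference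
    quotient of \<open>B(., m)\<close> at \<open>m\<close>.\<close>
  define g where "g t = f t - f m - deriv f m * (t - m)" for t
  have g: "(g has_real_derivative deriv f t - deriv f m) (at t)" for t
    unfolding g_def using f[of t] by (auto intro!: derivative_eq_intros)
  have "(g \<longlongrightarrow> g m) (at m)"
    using g[of m] DERIV_isCont isCont_def by blast
  then have g0: "(g \<longlongrightarrow> 0) (at m)"
    by (simp add: g_def)
  have quot: "((\<lambda>t. g t / (t - m)\<^sup>2) \<longlongrightarrow> D / 2) (at m)"
  proof (rule lhopital)
    show "(g \<longlongrightarrow> 0) (at m)" by fact
    show "((\<lambda>t. (t - m)\<^sup>2) \<longlongrightarrow> 0) (at m)"
      by (auto intro!: tendsto_eq_intros)
    show "\<forall>\<^sub>F t in at m. (t - m)\<^sup>2 \<noteq> 0" "\<forall>\<^sub>F t in at m. 2 * (t - m) \<noteq> 0"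
      by (auto simp: eventually_at_filter)
    show "\<forall>\<^sub>F t in at m. (g has_real_derivative deriv f t - deriv f m) (at t)"
      by (intro always_eventually allI g)
    show "\<forall>\<^sub>F t in at m. ((\<lambda>t. (t - m)\<^sup>2) has_real_derivative 2 * (t - m)) (at t)"
      by (intro always_eventually allI) (auto intro!: derivative_eq_intros)
    \<comment> \<open>One use of l'Hopital's rule leaves half the difference quotient of
      \<open>deriv f\<close> at \<open>m\<close>.\<close>
    have "((\<lambda>t. (deriv f t - deriv f m) / (t - m) / 2) \<longlongrightarrow> D / 2) (at m)"
      using f' by (intro tendsto_intros) (auto simp: has_field_derivative_iff)
    then show "((\<lambda>t. (deriv f t - deriv f m) / (2 * (t - m))) \<longlongrightarrow> D / 2) (at m)"
      by (simp add: mult.commute)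
  qed
  have "((\<lambda>t. (Bfun V X t m - Bfun V X m m) / (t - m)) \<longlongrightarrow> D / 2) (at m)"
    by (rule Lim_transform_eventually[OF quot])
       (auto simp: eventually_at_filter Bfun_def g_def f_def field_simps power2_eq_square
             intro!: always_eventually)
  then have "((\<lambda>t. Bfun V X t m) has_real_derivative D / 2) (at m)"
    by (simp add: has_field_derivative_iff)
  then show ?thesis
    using True real_differentiable_def by blast
qed

section \<open>The scalar equation along a line\<close>

lemma Kfun_convex_bound:
  assumes "\<And>s. s \<in> {1, -1} \<Longrightarrow> k \<le> Kfun V s X l m"
    and "\<bar>q\<bar> \<le> sqrt (l * m)"
  shows "k \<le> Bfun V X l m + 2 * deriv (\<lambda>t. Bfun V X t m) l * (l + q)"
proof -
  define d where "d = 2 * deriv (\<lambda>t. Bfun V X t m) l"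
  define r where "r = sqrt (l * m)"
  have plus: "k \<le> Bfun V X l m + d * (l + r)"
    and minus: "k \<le> Bfun V X l m + d * (l - r)"
    using assms(1)[of 1] assms(1)[of "-1"] by (auto simp: Kfun_def d_def r_def)
  show ?thesis
  \<comment> \<open>The expression is affine in \<open>q\<close>, so on \<open>[-r, r]\<close> it is
    smallest at an endpoint, selected by the sign of \<open>d\<close>.\<close>
  proof (cases "d \<ge> 0")
    case True
    then have "d * (l - r) \<le> d * (l + q)"
      using assms(2) by (intro mult_left_mono) (auto simp: r_def)
    then show ?thesis using minus by (simp add: d_def)
  next
    case False
    then have "d * (l + r) \<le> d * (l + q)"
      using assms(2) by (intro mult_left_mono_neg) (auto simp: r_def)
    then show ?thesis using plus by (simp add: d_def)
  qed
qed

text \<open>By the mean value theorem a uniform positive slope forces at least linear growth in both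
  directions. Hence the values are unbounded above and below, and the intermediate value theorem
  gives surjectivity.\<close>

lemma strict_mono_bij_of_deriv_ge:
  fixes f f' :: "real \<Rightarrow> real"
  assumes f: "\<And>x. (f has_real_derivative f' x) (at x)"
    and c: "0 < c" "\<And>x. c \<le> f' x"
  shows "strict_mono f" and "bij f"
proof -
  have growth: "c * (y - x) \<le> f y - f x" if xy: "x < y" for x y
  proof -
    obtain z where "f y - f x = (y - x) * f' z"
      using MVT2[OF xy, of f f'] f by blast
    then show ?thesis
      using c(2)[of z] xy by (simp add: mult.commute mult_left_mono)
  qed
  show mono: "strict_mono f"
  proof (rule strict_monoI)
    fix x y :: real assume "x < y"
    then have "0 < c * (y - x)" using c(1) by simp
    then show "f x < f y" using growth[OF \<open>x < y\<close>] by linarith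
  qed
  have "\<exists>x. f x = y" for y
  proof -
    \<comment> \<open>Over a length \<open>R\<close>, slope \<open>c\<close> covers the distance
      from \<open>f 0\<close> to \<open>y\<close>; the added 1 keeps \<open>R\<close> positive when
      \<open>y = f 0\<close>.\<close>
    define R where "R = (\<bar>y - f 0\<bar> + 1) / c"
    have R: "0 < R" "c * R = \<bar>y - f 0\<bar> + 1"
      using c(1) by (auto simp: R_def)
    have "f (- R) \<le> y" "y \<le> f R"
      using growth[of 0 R] growth[of "- R" 0] R by auto
    moreover have "continuous_on {- R..R} f"
      using f DERIV_isCont continuous_at_imp_continuous_on by blast
    ultimately show ?thesis
      using IVT'[of f "- R" y R] R(1) by auto
  qed
  then show "bij f"
    using mono by (metis bijI strict_mono_imp_inj_on surjI)
qed

lemma ray_map_strict_mono_bij: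
  fixes u e :: "'a::real_inner"
  assumes C2: "C2_real (V X)"
    and K: "\<And>s l m. s \<in> {1, -1} \<Longrightarrow> 0 \<le> l \<Longrightarrow> 0 \<le> m \<Longrightarrow> k \<le> Kfun V s X l m"
    and pos: "0 < 1 + \<tau>\<^sup>2 * k"
    and e: "norm e = 1"
  defines "f \<equiv> \<lambda>s. (1 + \<tau>\<^sup>2 * Bfun V X ((norm (s *\<^sub>R e - u))\<^sup>2) ((norm u)\<^sup>2)) * s"
  shows "strict_mono f" and "bij f"
proof -
  define m where "m = (norm u)\<^sup>2"
  define p where "p = e \<bullet> u"
  define l where "l s = (norm (s *\<^sub>R e - u))\<^sup>2" for s
  define B where "B t = Bfun V X t m" for t
  have ee: "e \<bullet> e = 1"
    using e by (simp add: dot_square_norm)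
  have l_eq: "l s = s\<^sup>2 - 2 * s * p + m" for s
    by (simp add: l_def m_def p_def power2_norm_eq_inner inner_diff_left inner_diff_right
        inner_commute[of u e] ee) (simp add: power2_eq_square algebra_simps)
  have B': "(B has_real_derivative deriv B t) (at t)" for t
    using Bfun_differentiable[where V = V and X = X, OF C2]
    by (simp add: B_def[abs_def] DERIV_deriv_iff_real_differentiable)
  have l': "(l has_real_derivative 2 * s - 2 * p) (at s)" for s
    unfolding l_eq[abs_def] by (auto intro!: derivative_eq_intros)
  define f' where
    "f' s = \<tau>\<^sup>2 * (deriv B (l s) * (2 * s - 2 * p)) * s + (1 + \<tau>\<^sup>2 * B (l s))" for s
  have f: "(f has_real_derivative f' s) (at s)" for s
  proof -
    have "((\<lambda>s. B (l s)) has_real_derivative deriv B (l s) * (2 * s - 2 * p)) (at s)"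
      by (rule DERIV_chain2[OF B' l'])
    then have "((\<lambda>s. (1 + \<tau>\<^sup>2 * B (l s)) * s) has_real_derivative f' s) (at s)"
      unfolding f'_def by (auto intro!: derivative_eq_intros)
    then show ?thesis
      by (simp add: f_def B_def l_def m_def)
  qed
  have bound: "1 + \<tau>\<^sup>2 * k \<le> f' s" for s
  proof -
    \<comment> \<open>By Cauchy-Schwarz \<open>q\<close> is admissible in
      \<open>Kfun_convex_bound\<close>. Moreover \<open>2 * (l s + q) = s * (2 * s - 2 * p)\<close>,
      which is the factor that the chain and product rules put beside \<open>deriv B (l s)\<close>
      in \<open>f'\<close>.\<close>
    define q where "q = (s *\<^sub>R e - u) \<bullet> u"
    have q: "q = s * p - m"
      by (simp add: q_def p_def m_def inner_diff_left power2_norm_eq_inner)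
    have "\<bar>q\<bar> \<le> norm (s *\<^sub>R e - u) * norm u"
      unfolding q_def by (rule Cauchy_Schwarz_ineq2)
    also have "\<dots> = sqrt (l s * m)"
      by (simp add: l_def m_def real_sqrt_mult)
    finally have "k \<le> B (l s) + 2 * deriv B (l s) * (l s + q)"
      unfolding B_def by (intro Kfun_convex_bound K) (auto simp: l_def m_def)
    also have "l s + q = s\<^sup>2 - s * p"
      by (simp add: l_eq q)
    finally have "\<tau>\<^sup>2 * k \<le> \<tau>\<^sup>2 * (B (l s) + 2 * deriv B (l s) * (s\<^sup>2 - s * p))"
      by (rule mult_left_mono) simp
    then show ?thesis
      by (simp add: f'_def algebra_simps power2_eq_square)
  qed
  show "strict_mono f" "bij f"
    using strict_mono_bij_of_deriv_ge[OF f pos bound] by auto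
qed

section \<open>Unique solvability at a single lattice site\<close>

lemma ex1_pointwise_step:
  fixes u \<eta> :: "'a::real_inner"
  assumes C2: "C2_real (V X)"
    and K: "\<And>s l m. s \<in> {1, -1} \<Longrightarrow> 0 \<le> l \<Longrightarrow> 0 \<le> m \<Longrightarrow> k \<le> Kfun V s X l m"
    and pos: "0 < 1 + \<tau>\<^sup>2 * k"
  shows "\<exists>!w. (1 + \<tau>\<^sup>2 * Bfun V X ((norm w)\<^sup>2) ((norm u)\<^sup>2)) *\<^sub>R (w + u) = \<eta>"
proof -
  define f where
    "f e s = (1 + \<tau>\<^sup>2 * Bfun V X ((norm (s *\<^sub>R e - u))\<^sup>2) ((norm u)\<^sup>2)) * s" for e s
  define G where
    "G v = (1 + \<tau>\<^sup>2 * Bfun V X ((norm (v - u))\<^sup>2) ((norm u)\<^sup>2)) *\<^sub>R v" for v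
  have mono: "strict_mono (f e)" and bij: "bij (f e)" if "norm e = 1" for e
    using ray_map_strict_mono_bij[OF C2 K pos that, of u] by (simp_all add: f_def[abs_def])
  have Gf: "G (s *\<^sub>R e) = f e s *\<^sub>R e" for s e
    by (simp add: G_def f_def)
  have f0: "f e 0 = 0" for e
    by (simp add: f_def)
  \<comment> \<open>As \<open>f e\<close> increases from \<open>f e 0 = 0\<close>, \<open>G\<close>
    multiplies every nonzero vector by a positive factor. So a solution for
    \<open>\<eta> \<noteq> 0\<close> points along \<open>\<eta>\<close>, and only its length remains
    to be found; for \<open>\<eta> = 0\<close> it must vanish.\<close>
  have G_norm: "G v = f (sgn v) (norm v) *\<^sub>R sgn v \<and> 0 < f (sgn v) (norm v)" if "v \<noteq> 0" for v
  proof -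
    have "f (sgn v) 0 < f (sgn v) (norm v)"
      using mono[of "sgn v"] that by (simp add: norm_sgn strict_mono_less)
    moreover have "norm v *\<^sub>R sgn v = v"
      using that by (simp add: sgn_div_norm)
    ultimately show ?thesis
      using Gf[of "norm v" "sgn v"] by (simp add: f0)
  qed
  have "\<exists>!v. G v = \<eta>"
  proof (cases "\<eta> = 0")
    case True
    then show ?thesis
      using G_norm by (intro ex1I[of _ 0]) (force simp: G_def sgn_zero_iff)+
  next
    case False
    define e where "e = sgn \<eta>"
    have e: "norm e = 1" and \<eta>: "\<eta> = norm \<eta> *\<^sub>R e"
      using False by (auto simp: e_def norm_sgn sgn_div_norm)
    obtain s where s: "f e s = norm \<eta>"
      using bij[OF e] by (metis bij_pointE)
    show ?thesis
    proof (rule ex1I)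
      show "G (s *\<^sub>R e) = \<eta>"
        using Gf s \<eta> by simp
    next
      fix v assume v: "G v = \<eta>"
      then have "v \<noteq> 0" using False by (auto simp: G_def)
      then have dec: "G v = f (sgn v) (norm v) *\<^sub>R sgn v" "0 < f (sgn v) (norm v)"
        using G_norm by auto
      have "norm (sgn v) = 1"
        using \<open>v \<noteq> 0\<close> by (simp add: norm_sgn)
      have "sgn \<eta> = sgn v"
        using dec(2) \<open>norm (sgn v) = 1\<close> sgn_div_norm[of "sgn v"]
        by (simp add: v[symmetric] dec(1) sgn_scaleR)
      moreover have "norm \<eta> = f (sgn v) (norm v)"
        using dec(2) \<open>norm (sgn v) = 1\<close> by (simp add: v[symmetric] dec(1))
      ultimately have "f e (norm v) = f e s"
        using s by (simp add: e_def)
      then have "norm v = s"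
        using bij[OF e] by (simp add: bij_is_inj inj_eq)
      then show "v = s *\<^sub>R e"
        using \<open>sgn \<eta> = sgn v\<close> \<open>v \<noteq> 0\<close> by (auto simp: e_def sgn_div_norm)
    qed
  qed
  then obtain v where v: "G v = \<eta>" "\<And>v'. G v' = \<eta> \<Longrightarrow> v' = v" by blast
  have GG: "(1 + \<tau>\<^sup>2 * Bfun V X ((norm w)\<^sup>2) ((norm u)\<^sup>2)) *\<^sub>R (w + u) = G (w + u)" for w
    by (simp add: G_def)
  show ?thesis
    unfolding GG
  proof (rule ex1I[of _ "v - u"])
    show "G (v - u + u) = \<eta>" using v(1) by simp
    show "w = v - u" if "G (w + u) = \<eta>" for w
      using v(2)[OF that] by (simp add: eq_diff_eq)
  qed
qed

section \<open>Two-sided orbits of reversible second-order recurrences\<close>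

fun two_term_rec :: "('s \<Rightarrow> 's \<Rightarrow> 's) \<Rightarrow> 's \<Rightarrow> 's \<Rightarrow> nat \<Rightarrow> 's" where
  "two_term_rec F a b 0 = a"
| "two_term_rec F a b (Suc 0) = b"
| "two_term_rec F a b (Suc (Suc n)) = F (two_term_rec F a b n) (two_term_rec F a b (Suc n))"

lemma two_term_rec_unique:
  assumes "h 0 = a" "h (Suc 0) = b" "\<And>n. h (Suc (Suc n)) = F (h n) (h (Suc n))"
  shows "h n = two_term_rec F a b n"
  by (induction n rule: induct_nat_012) (use assms in auto)

text \<open>The symmetry of \<open>P\<close> exchanges past and future, so running backwards is the
  same recursion started from the swapped pair \<open>s1\<close>, \<open>s0\<close>.\<close>

lemma ex1_reversible_orbit:
  fixes P :: "'s \<Rightarrow> 's \<Rightarrow> 's \<Rightarrow> bool" and s0 s1 :: 's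
  assumes ex1: "\<And>a b. \<exists>!c. P a b c"
    and sym: "\<And>a b c. P a b c \<longleftrightarrow> P c b a"
  shows "\<exists>!f :: int \<Rightarrow> 's. (\<forall>T. P (f (T - 1)) (f T) (f (T + 1))) \<and> f 0 = s0 \<and> f 1 = s1"
proof -
  define F where "F a b = (THE c. P a b c)" for a b
  have PF: "P a b c \<longleftrightarrow> c = F a b" for a b c
    unfolding F_def using ex1 by (metis theI')
  define R where "R = two_term_rec F"
  \<comment> \<open>In the backward branch index \<open>n\<close> stands for time
    \<open>1 - n\<close>; both recursions therefore cover the times 0 and 1, where they
    agree.\<close>
  define f where "f T = (if 0 \<le> T then R s0 s1 (nat T) else R s1 s0 (nat (1 - T)))" for T :: int
  have f_fwd: "f (int n) = R s0 s1 n" for n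
    by (simp add: f_def)
  have f_bwd: "f (1 - int n) = R s1 s0 n" for n
  proof -
    \<comment> \<open>For \<open>n = 0\<close> and \<open>n = 1\<close> the time
      \<open>1 - n\<close> is still nonnegative, so \<open>f\<close> is given there by the forward
      branch.\<close>
    consider "n = 0" | "n = 1" | "1 < n" by linarith
    then show ?thesis by cases (auto simp: f_def R_def)
  qed
  have sol: "P (f (T - 1)) (f T) (f (T + 1))" for T
  proof (cases "1 \<le> T")
    case True
    define n where "n = nat (T - 1)"
    have "T - 1 = int n" "T = int (Suc n)" "T + 1 = int (Suc (Suc n))"
      using True by (auto simp: n_def)
    then have "f (T - 1) = R s0 s1 n" "f T = R s0 s1 (Suc n)" "f (T + 1) = R s0 s1 (Suc (Suc n))"
      using f_fwd by metis+
    then show ?thesis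
      by (simp add: PF R_def)
  next
    case False
    define n where "n = nat (- T)"
    have "T + 1 = 1 - int n" "T = 1 - int (Suc n)" "T - 1 = 1 - int (Suc (Suc n))"
      using False by (auto simp: n_def)
    then have "f (T + 1) = R s1 s0 n" "f T = R s1 s0 (Suc n)" "f (T - 1) = R s1 s0 (Suc (Suc n))"
      using f_bwd by metis+
    then show ?thesis
      by (subst sym) (simp add: PF R_def)
  qed
  show ?thesis
  proof (rule ex1I[of _ f])
    show "(\<forall>T. P (f (T - 1)) (f T) (f (T + 1))) \<and> f 0 = s0 \<and> f 1 = s1"
      using sol f_fwd[of 0] f_fwd[of 1] by (simp add: R_def)
  next
    fix h :: "int \<Rightarrow> 's"
    assume h: "(\<forall>T. P (h (T - 1)) (h T) (h (T + 1))) \<and> h 0 = s0 \<and> h 1 = s1"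
    then have up: "h (T + 1) = F (h (T - 1)) (h T)"
      and down: "h (T - 1) = F (h (T + 1)) (h T)" for T
      using PF sym by blast+
    have fwd: "h (int n) = R s0 s1 n" for n
      unfolding R_def
    proof (rule two_term_rec_unique)
      show "h (int (Suc (Suc n))) = F (h (int n)) (h (int (Suc n)))" for n
        using up[of "int (Suc n)"] by (simp add: add_ac)
    qed (use h in auto)
    have bwd: "h (1 - int n) = R s1 s0 n" for n
      unfolding R_def
    proof (rule two_term_rec_unique)
      show "h (1 - int (Suc (Suc n))) = F (h (1 - int n)) (h (1 - int (Suc n)))" for n
      proof -
        have "1 - int (Suc n) - 1 = 1 - int (Suc (Suc n))" "1 - int (Suc n) + 1 = 1 - int n"
          by simp_all
        then show ?thesis
          using down by metis
      qed
    qed (use h in auto)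
    show "h = f"
    proof
      fix T
      show "h T = f T"
        using fwd[of "nat T"] bwd[of "nat (1 - T)"] by (auto simp: f_def)
    qed
  qed
qed

section \<open>The step-size condition and the Cauchy problem\<close>

lemma one_plus_tau_k2_pos:
  assumes "0 < \<tau>" and "ereal \<tau> < tau2 V"
  shows "0 < 1 + \<tau>\<^sup>2 * k2 V"
proof (cases "k2 V < 0")
  case True
  \<comment> \<open>For negative \<open>k2 V\<close>, \<open>tau2 V\<close> is the positive zero of
    \<open>1 + \<tau>\<^sup>2 * k2 V\<close> as a function of \<open>\<tau>\<close>.\<close>
  then have "\<tau> < sqrt (- 1 / k2 V)"
    using assms(2) by (simp add: tau2_def)
  then have "\<tau>\<^sup>2 < - 1 / k2 V"
    using assms(1)
    by (metis less_eq_real_def power2_eq_square real_sqrt_abs2 real_sqrt_less_iff real_sqrt_unique)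
  then show ?thesis
    using True by (simp add: field_simps)
next
  case False
  then show ?thesis by (simp add: add_pos_nonneg)
qed

lemma k2_le_Kfun:
  assumes "bdd_below (Kvals V)" "s \<in> {1, -1}" "0 \<le> l" "0 \<le> m"
  shows "k2 V \<le> Kfun V s X l m"
  unfolding k2_def using assms by (intro cInf_lower) (auto simp: Kvals_def)

theorem theorem2p6:
  fixes V :: "int ^ 'n \<Rightarrow> real \<Rightarrow> real"
    and \<tau> \<epsilon> :: real
    and \<psi>0 \<psi>1 :: "int ^ 'n \<Rightarrow> complex ^ 'N"
  assumes "\<And>X. C2_real (V X)"
    and "bdd_below (Kvals V)"
    and "0 < \<tau>" and "ereal \<tau> < tau2 V"
    and "0 < \<epsilon>"
  shows "\<exists>!\<psi> :: int ^ 'n \<Rightarrow> int \<Rightarrow> complex ^ 'N.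
           discrete_wave_solution V \<tau> \<epsilon> \<psi> \<and>
           (\<forall>X. \<psi> X 0 = \<psi>0 X) \<and> (\<forall>X. \<psi> X 1 = \<psi>1 X)"
proof -
  \<comment> \<open>The discrete Laplacian involves only the middle time level. Hence each time step
    decouples into one equation \<open>Q\<close> per site, with \<open>\<eta>\<close> collecting the
    middle-level terms, while \<open>P\<close> collects these equations over the lattice.\<close>
  define L where "L b X = (\<Sum>j\<in>UNIV. (b (X + axis j 1) - 2 *\<^sub>R b X + b (X - axis j 1)) /\<^sub>R \<epsilon>\<^sup>2)"
    for b :: "int ^ 'n \<Rightarrow> complex ^ 'N" and X
  define Q where "Q X a \<eta> c \<longleftrightarrow>
      (1 + \<tau>\<^sup>2 * Bfun V X ((norm c)\<^sup>2) ((norm a)\<^sup>2)) *\<^sub>R (c + a) = \<eta>"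
    for X and a \<eta> c :: "complex ^ 'N"
  define P where "P a b c \<longleftrightarrow> (\<forall>X. Q X (a X) (2 *\<^sub>R b X + \<tau>\<^sup>2 *\<^sub>R L b X) (c X))"
    for a b c :: "int ^ 'n \<Rightarrow> complex ^ 'N"
  have Q_ex1: "\<exists>!c. Q X a \<eta> c" for X a \<eta>
    unfolding Q_def
    by (rule ex1_pointwise_step[where k = "k2 V"])
       (use assms(1) k2_le_Kfun[OF assms(2)] one_plus_tau_k2_pos[OF assms(3,4)] in blast)+
  have Q_sym: "Q X a \<eta> c \<longleftrightarrow> Q X c \<eta> a" for X a \<eta> c
    by (simp add: Q_def Bfun_commute[of V X "(norm a)\<^sup>2"] add.commute)
  have P_ex1: "\<exists>!c. P a b c" for a b
  proof -
    have "\<exists>!c. \<forall>X. Q X (a X) (\<eta> X) (c X)" for \<eta>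
    proof -
      define c where "c X = (THE w. Q X (a X) (\<eta> X) w)" for X
      have c: "\<forall>X. Q X (a X) (\<eta> X) (c X)"
        unfolding c_def using theI'[OF Q_ex1] by simp
      show ?thesis
      proof (rule ex1I[of _ c])
        show "c' = c" if "\<forall>X. Q X (a X) (\<eta> X) (c' X)" for c'
          using that c Q_ex1 by (intro ext) blast
      qed (fact c)
    qed
    then show ?thesis
      by (simp add: P_def)
  qed
  have P_sym: "P a b c \<longleftrightarrow> P c b a" for a b c
    using Q_sym by (simp add: P_def)
  have step: "(c - 2 *\<^sub>R b + a) /\<^sub>R \<tau>\<^sup>2 = l - B *\<^sub>R (c + a) \<longleftrightarrow>
      (1 + \<tau>\<^sup>2 * B) *\<^sub>R (c + a) = 2 *\<^sub>R b + \<tau>\<^sup>2 *\<^sub>R l" for a b c l :: "complex ^ 'N" and B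
  proof -
    have "z /\<^sub>R \<tau>\<^sup>2 = y \<longleftrightarrow> z = \<tau>\<^sup>2 *\<^sub>R y" for y z :: "complex ^ 'N"
      using assms(3) by auto
    then have "(c - 2 *\<^sub>R b + a) /\<^sub>R \<tau>\<^sup>2 = l - B *\<^sub>R (c + a) \<longleftrightarrow>
        c - 2 *\<^sub>R b + a = \<tau>\<^sup>2 *\<^sub>R (l - B *\<^sub>R (c + a))"
      by blast
    also have "\<dots> \<longleftrightarrow> (1 + \<tau>\<^sup>2 * B) *\<^sub>R (c + a) = 2 *\<^sub>R b + \<tau>\<^sup>2 *\<^sub>R l"
      by (auto simp: algebra_simps)
    finally show ?thesis .
  qed
  have sol_iff: "discrete_wave_solution V \<tau> \<epsilon> \<psi> \<longleftrightarrow>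
      (\<forall>T. P (\<lambda>X. \<psi> X (T - 1)) (\<lambda>X. \<psi> X T) (\<lambda>X. \<psi> X (T + 1)))" for \<psi>
    unfolding discrete_wave_solution_def P_def Q_def L_def step by blast
  \<comment> \<open>The orbit lemma is applied with whole lattice functions as states, so time
    becomes the first argument of \<open>f\<close>.\<close>
  obtain f where f: "\<forall>T. P (f (T - 1)) (f T) (f (T + 1))" "f 0 = \<psi>0" "f 1 = \<psi>1"
    and unique: "\<And>h. (\<forall>T::int. P (h (T - 1)) (h T) (h (T + 1))) \<and> h 0 = \<psi>0 \<and> h 1 = \<psi>1 \<Longrightarrow> h = f"
    using ex1_reversible_orbit[of P \<psi>0 \<psi>1, OF P_ex1 P_sym] by blast
  show ?thesis
  proof (rule ex1I[of _ "\<lambda>X T. f T X"])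
    show "discrete_wave_solution V \<tau> \<epsilon> (\<lambda>X T. f T X) \<and>
        (\<forall>X. f 0 X = \<psi>0 X) \<and> (\<forall>X. f 1 X = \<psi>1 X)"
      using f by (simp add: sol_iff)
  next
    fix \<psi> :: "int ^ 'n \<Rightarrow> int \<Rightarrow> complex ^ 'N"
    assume "discrete_wave_solution V \<tau> \<epsilon> \<psi> \<and>
        (\<forall>X. \<psi> X 0 = \<psi>0 X) \<and> (\<forall>X. \<psi> X 1 = \<psi>1 X)"
    then have "(\<lambda>T X. \<psi> X T) = f"
      by (intro unique) (auto simp: sol_iff)
    then show "\<psi> = (\<lambda>X T. f T X)"
      by auto
  qed
qed

end
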